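(* Let $\mathcal M=(\mathcal M,I,\otimes)$ be a large monoidal category, $\mathsf T=(T,e,m)$ a monoid object in $\mathcal M$, $\mathcal C$ a large category and $\Phi$ a metamodel of $\mathcal M$ in $\mathcal C$. Let $\mathbf{Mod}(\mathsf T,\mathcal C)$ be the category of models of $\mathsf T$ in $\mathcal C$ with respect to $\Phi$, $U\colon\mathbf{Mod}(\mathsf T,\mathcal C)\to\mathcal C$ the forgetful functor, and $u$ the natural transformation $u_{(C,\xi),(C',\xi')}\colon\mathbf{Mod}(\mathsf T,\mathcal C)((C,\xi),(C',\xi'))\to\Phi_T(C,C')$ given by $u(f)=\Phi_T(C,f)(\xi)=\Phi_T(f,C')(\xi')$. Then $(\mathbf{Mod}(\mathsf T,\mathcal C),U,u)$ is a universal vertical double cone over $\Phi(\mathsf T)$, namely: 1. it is a vertical double cone over $\Phi(\mathsf T)$; 2. for any vertical double cone $(\mathcal A,V,v)$ over $\Phi(\mathsf T)$ there exists a unique functor $K\colon\mathcal A\to\mathbf{Mod}(\mathsf T,\mathcal C)$ such that $U\circ K=V$ and $u_{KA,KB}(Kf)=v_{A,B}(f)$ for every morphism $f\colon A\to B$ of $\mathcal A$; 3. for any pair of vertical double cones $(\mathcal A,V,v)$ and $(\mathcal A',V',v')$ over $\Phi(\mathsf T)$, any functor $H\colon\mathcal A^{\mathrm{op}}\times\mathcal A'\to\mathbf{SET}$ and any natural transformation $\theta=(\theta_{A,A'}\colon H(A,A')\to\mathcal C(VA,V'A'))_{A\in\mathcal A,A'\in\mathcal A'}$ such that $$\Phi_T(VA,\theta_{A,A'}(x))(v_{A,A}(\mathrm{id}_A))=\Phi_T(\theta_{A,A'}(x),V'A')(v'_{A',A'}(\mathrm{id}_{A'}))$$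 for all $A\in\mathcal A$, $A'\in\mathcal A'$, $x\in H(A,A')$, there exists a unique natural transformation $\sigma=(\sigma_{A,A'}\colon H(A,A')\to\mathbf{Mod}(\mathsf T,\mathcal C)(KA,K'A'))_{A,A'}$ such that $U(\sigma_{A,A'}(x))=\theta_{A,A'}(x)$ for all $A,A',x$, where $K,K'$ are the functors corresponding by 2 to $(\mathcal A,V,v)$ and $(\mathcal A',V',v')$ respectively.
   Context: Sizes: fix universes $\mathcal U_1\in\mathcal U_2\in\mathcal U_3$; "small" and "large" mean being an element of $\mathcal U_1$, $\mathcal U_2$; $\mathbf{SET}$ is the category of large sets. Metamodel. A metamodel of a large monoidal category $\mathcal{M}$ in a large category $\mathcal{C}$ consists of a functor $\Phi\colon\mathcal{M}^{\mathrm{op}}\times\mathcal{C}^{\mathrm{op}}\times\mathcal{C}\to\mathbf{SET}$, $(X,A,B)\mapsto\Phi_X(A,B)$; an (extra)natural family $(\overline{\phi}_\cdot)_C\colon 1\to\Phi_I(C,C)$; and an (extra)natural family $(\overline{\phi}_{X,Y})_{A,B,C}\colon\Phi_Y(B,C)\times\Phi_X(A,B)\to\Phi_{Y\otimes X}(A,C)$; such that, modulo $\Phi$ applied to the coherence isomorphisms of $\mathcal{M}$, $\overline\phi$ is associative and $\overline{\phi}_\cdot$ is a left and right unit for it. Write $(\phi_\cdot)_{A,B}\colon\mathcal C(A,B)\to\Phi_I(A,B)$ for the natural transformation corresponding to $\overline\phi_\cdot$ by the Yoneda lemma: $(\phi_\cdot)_{A,B}(f)=\Phi_I(A,f)((\overline\phi_\cdot)_A(\ast))$.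 Models. A model of $\mathsf T=(T,e,m)$ in $\mathcal C$ with respect to $\Phi$ is a pair $(C,\xi)$ with $C\in\mathcal C$ and $\xi\in\Phi_T(C,C)$ such that $(\Phi_e)_{C,C}(\xi)=(\overline\phi_\cdot)_C(\ast)$ and $(\Phi_m)_{C,C}(\xi)=(\overline\phi_{T,T})_{C,C,C}(\xi,\xi)$. A homomorphism $(C,\xi)\to(C',\xi')$ is a morphism $f\colon C\to C'$ in $\mathcal C$ with $\Phi_T(C,f)(\xi)=\Phi_T(f,C')(\xi')$. These form the category $\mathbf{Mod}(\mathsf T,\mathcal C)$. Vertical double cone. A vertical double cone over $\Phi(\mathsf T)$ is a triple $(\mathcal A,V,v)$ consisting of a large category $\mathcal A$, a functor $V\colon\mathcal A\to\mathcal C$ and a natural transformation $v=(v_{A,B}\colon\mathcal A(A,B)\to\Phi_T(VA,VB))_{A,B\in\mathcal A}$ such that (i) $(\Phi_e)_{VA,VB}(v_{A,B}(f))=(\phi_\cdot)_{VA,VB}(Vf)$ for all $f\colon A\to B$ in $\mathcal A$, and (ii) $(\Phi_m)_{VA,VC}(v_{A,C}(g\circ h))=(\overline\phi_{T,T})_{VA,VB,VC}(v_{B,C}(g),v_{A,B}(h))$ for all $h\colon A\to B$, $g\colon B\to C$ in $\mathcal A$. (These are the elementwise forms of equations between squares in the pseudo double category $\mathbb{PROF}^{\mathrm{op}}$, whose objects are large categories, vertical morphisms are functors, horizontal morphisms from $\mathcal A$ to $\mathcal B$ are functors $H\colon\mathcal A^{\mathrm{op}}\times\mathcal B\to\mathbf{SET}$,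 and squares with vertical sides $F\colon\mathcal A\to\mathcal A'$, $G\colon\mathcal B\to\mathcal B'$ and horizontal sides $H,H'$ are natural transformations $H(A,B)\to H'(FA,GB)$; horizontal identities are hom-functors and horizontal composition is by coends.) *)

theory Defs
  imports Main "HOL-Library.FuncSet"
begin

section \<open>Categories and functors\<close>

text \<open>
  Categories are given by hom-sets, which need not be disjoint. Therefore composition carries its
  objects: \<open>Comp C X Y Z g f\<close> is \<open>g \<circ> f\<close> for \<open>f : X \<rightarrow> Y\<close> and \<open>g : Y \<rightarrow> Z\<close>. Type variables play the
  role of the universe of large sets; no category, hom-set or set-valued functor below is subject to
  a size restriction other than that its elements form a type.
\<close>

record ('o, 'm) cat =
  Obj :: "'o set"
  Hom :: "'o \<Rightarrow> 'o \<Rightarrow> 'm set"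
  Ident :: "'o \<Rightarrow> 'm"
  Comp :: "'o \<Rightarrow> 'o \<Rightarrow> 'o \<Rightarrow> 'm \<Rightarrow> 'm \<Rightarrow> 'm"

locale category =
  fixes C :: "('o, 'm, 'z) cat_scheme"
  assumes Ident_in: "X \<in> Obj C \<Longrightarrow> Ident C X \<in> Hom C X X"
    and Comp_in: "\<lbrakk>X \<in> Obj C; Y \<in> Obj C; Z \<in> Obj C; f \<in> Hom C X Y; g \<in> Hom C Y Z\<rbrakk>
      \<Longrightarrow> Comp C X Y Z g f \<in> Hom C X Z"
    and Comp_Ident_right: "\<lbrakk>X \<in> Obj C; Y \<in> Obj C; f \<in> Hom C X Y\<rbrakk>
      \<Longrightarrow> Comp C X X Y f (Ident C X) = f"
    and Comp_Ident_left: "\<lbrakk>X \<in> Obj C; Y \<in> Obj C; f \<in> Hom C X Y\<rbrakk>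
      \<Longrightarrow> Comp C X Y Y (Ident C Y) f = f"
    and Comp_assoc: "\<lbrakk>W \<in> Obj C; X \<in> Obj C; Y \<in> Obj C; Z \<in> Obj C;
        f \<in> Hom C W X; g \<in> Hom C X Y; h \<in> Hom C Y Z\<rbrakk>
      \<Longrightarrow> Comp C W X Z (Comp C X Y Z h g) f = Comp C W Y Z h (Comp C W X Y g f)"

definition op_cat :: "('o, 'm, 'z) cat_scheme \<Rightarrow> ('o, 'm) cat" where
  "op_cat C = \<lparr>Obj = Obj C, Hom = (\<lambda>X Y. Hom C Y X), Ident = Ident C,
     Comp = (\<lambda>X Y Z g f. Comp C Z Y X f g)\<rparr>"

definition prod_cat ::
  "('o1, 'm1, 'z1) cat_scheme \<Rightarrow> ('o2, 'm2, 'z2) cat_scheme \<Rightarrow> ('o1 \<times> 'o2, 'm1 \<times> 'm2) cat" where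
  "prod_cat C D = \<lparr>Obj = Obj C \<times> Obj D,
     Hom = (\<lambda>X Y. Hom C (fst X) (fst Y) \<times> Hom D (snd X) (snd Y)),
     Ident = (\<lambda>X. (Ident C (fst X), Ident D (snd X))),
     Comp = (\<lambda>X Y Z g f. (Comp C (fst X) (fst Y) (fst Z) (fst g) (fst f),
                          Comp D (snd X) (snd Y) (snd Z) (snd g) (snd f)))\<rparr>"

text \<open>The category of sets with elements in \<open>'s\<close>; maps are \<open>undefined\<close> outside their domain, so that
  equality of maps is equality of functions.\<close>

definition set_cat :: "('s set, 's \<Rightarrow> 's) cat" where
  "set_cat = \<lparr>Obj = UNIV, Hom = (\<lambda>X Y. X \<rightarrow>\<^sub>E Y), Ident = (\<lambda>X. \<lambda>x\<in>X. x),
     Comp = (\<lambda>X Y Z g f. compose X g f)\<rparr>"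

text \<open>\<open>farr F X Y f\<close> is the value of the functor \<open>F\<close> at \<open>f : X \<rightarrow> Y\<close>.\<close>

record ('o1, 'm1, 'o2, 'm2) ftor =
  fobj :: "'o1 \<Rightarrow> 'o2"
  farr :: "'o1 \<Rightarrow> 'o1 \<Rightarrow> 'm1 \<Rightarrow> 'm2"

text \<open>Functors are \<open>undefined\<close> outside their domain (the two \<open>ext\<close> axioms), so that equality of
  functors is equality of records.\<close>

locale is_functor =
  fixes A :: "('o1, 'm1, 'z1) cat_scheme" and B :: "('o2, 'm2, 'z2) cat_scheme"
    and F :: "('o1, 'm1, 'o2, 'm2) ftor"
  assumes category_dom: "category A" and category_cod: "category B"
    and fobj_in: "X \<in> Obj A \<Longrightarrow> fobj F X \<in> Obj B"
    and farr_in: "\<lbrakk>X \<in> Obj A; Y \<in> Obj A; f \<in> Hom A X Y\<rbrakk>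
      \<Longrightarrow> farr F X Y f \<in> Hom B (fobj F X) (fobj F Y)"
    and farr_Ident: "X \<in> Obj A \<Longrightarrow> farr F X X (Ident A X) = Ident B (fobj F X)"
    and farr_Comp: "\<lbrakk>X \<in> Obj A; Y \<in> Obj A; Z \<in> Obj A; f \<in> Hom A X Y; g \<in> Hom A Y Z\<rbrakk>
      \<Longrightarrow> farr F X Z (Comp A X Y Z g f)
        = Comp B (fobj F X) (fobj F Y) (fobj F Z) (farr F Y Z g) (farr F X Y f)"
    and fobj_ext: "X \<notin> Obj A \<Longrightarrow> fobj F X = undefined"
    and farr_ext: "\<not> (X \<in> Obj A \<and> Y \<in> Obj A \<and> f \<in> Hom A X Y) \<Longrightarrow> farr F X Y f = undefined"

definition mk_ftor ::
  "('o1, 'm1, 'z1) cat_scheme \<Rightarrow> ('o1 \<Rightarrow> 'o2) \<Rightarrow> ('o1 \<Rightarrow> 'o1 \<Rightarrow> 'm1 \<Rightarrow> 'm2)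
    \<Rightarrow> ('o1, 'm1, 'o2, 'm2) ftor" where
  "mk_ftor A fo fa = \<lparr>fobj = (\<lambda>X. if X \<in> Obj A then fo X else undefined),
     farr = (\<lambda>X Y f. if X \<in> Obj A \<and> Y \<in> Obj A \<and> f \<in> Hom A X Y then fa X Y f else undefined)\<rparr>"

definition comp_ftor ::
  "('o1, 'm1, 'z1) cat_scheme \<Rightarrow> ('o2, 'm2, 'o3, 'm3) ftor \<Rightarrow> ('o1, 'm1, 'o2, 'm2) ftor
    \<Rightarrow> ('o1, 'm1, 'o3, 'm3) ftor" where
  "comp_ftor A G F = mk_ftor A (\<lambda>X. fobj G (fobj F X))
     (\<lambda>X Y f. farr G (fobj F X) (fobj F Y) (farr F X Y f))"


section \<open>Set-valued functors of two variables and their transformations\<close>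

text \<open>A functor \<open>A\<^sup>o\<^sup>p \<times> B \<rightarrow> SET\<close>.\<close>

type_synonym ('a, 'am, 'b, 'bm, 's) prof = "('a \<times> 'b, 'am \<times> 'bm, 's set, 's \<Rightarrow> 's) ftor"

locale profunctor =
  fixes A :: "('a, 'am, 'z1) cat_scheme" and B :: "('b, 'bm, 'z2) cat_scheme"
    and H :: "('a, 'am, 'b, 'bm, 's) prof"
  assumes category_left: "category A" and category_right: "category B"
    and functor_prof: "is_functor (prod_cat (op_cat A) B) set_cat H"

definition hom_prof :: "('o, 'm, 'z) cat_scheme \<Rightarrow> ('o, 'm, 'o, 'm, 'm) prof" where
  "hom_prof C = mk_ftor (prod_cat (op_cat C) C) (\<lambda>(X, Y). Hom C X Y)
     (\<lambda>(X, Y) (X', Y') (f, g). \<lambda>h\<in>Hom C X Y. Comp C X' Y Y' g (Comp C X' X Y h f))"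

text \<open>Natural transformations \<open>H(a,b) \<rightarrow> H'(Fa,Gb)\<close>. The sets \<open>H(a,b)\<close> and \<open>H'(Fa,Gb)\<close> may have
  elements in different types.\<close>

locale prof_square =
  fixes A :: "('a, 'am, 'z1) cat_scheme" and B :: "('b, 'bm, 'z2) cat_scheme"
    and A' :: "('c, 'cm, 'z3) cat_scheme" and B' :: "('d, 'dm, 'z4) cat_scheme"
    and F :: "('a, 'am, 'c, 'cm) ftor" and G :: "('b, 'bm, 'd, 'dm) ftor"
    and H :: "('a, 'am, 'b, 'bm, 's) prof" and H' :: "('c, 'cm, 'd, 'dm, 't) prof"
    and \<theta> :: "'a \<Rightarrow> 'b \<Rightarrow> 's \<Rightarrow> 't"
  assumes functor_left: "is_functor A A' F" and functor_right: "is_functor B B' G"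
    and prof_top: "profunctor A B H" and prof_bottom: "profunctor A' B' H'"
    and component: "\<lbrakk>a \<in> Obj A; b \<in> Obj B\<rbrakk>
      \<Longrightarrow> \<theta> a b \<in> fobj H (a, b) \<rightarrow>\<^sub>E fobj H' (fobj F a, fobj G b)"
    and component_ext: "\<not> (a \<in> Obj A \<and> b \<in> Obj B) \<Longrightarrow> \<theta> a b = undefined"
    and natural: "\<lbrakk>a \<in> Obj A; a' \<in> Obj A; b \<in> Obj B; b' \<in> Obj B;
        f \<in> Hom A a' a; g \<in> Hom B b b'; x \<in> fobj H (a, b)\<rbrakk>
      \<Longrightarrow> \<theta> a' b' (farr H (a, b) (a', b') (f, g) x)
        = farr H' (fobj F a, fobj G b) (fobj F a', fobj G b') (farr F a' a f, farr G b b' g)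
            (\<theta> a b x)"


section \<open>Monoidal categories and monoid objects\<close>

record ('o, 'm) moncat = "('o, 'm) cat" +
  Tensor :: "('o \<times> 'o, 'm \<times> 'm, 'o, 'm) ftor"
  Unit :: 'o
  Assoc :: "'o \<Rightarrow> 'o \<Rightarrow> 'o \<Rightarrow> 'm"
  LUnit :: "'o \<Rightarrow> 'm"
  RUnit :: "'o \<Rightarrow> 'm"

definition is_iso :: "('o, 'm, 'z) cat_scheme \<Rightarrow> 'o \<Rightarrow> 'o \<Rightarrow> 'm \<Rightarrow> bool" where
  "is_iso C X Y f \<longleftrightarrow> f \<in> Hom C X Y \<and>
     (\<exists>g\<in>Hom C Y X. Comp C X Y X g f = Ident C X \<and> Comp C Y X Y f g = Ident C Y)"

definition tob :: "('o, 'm, 'z) moncat_scheme \<Rightarrow> 'o \<Rightarrow> 'o \<Rightarrow> 'o" where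
  "tob M X Y = fobj (Tensor M) (X, Y)"

text \<open>\<open>f \<otimes> g : X \<otimes> Y \<rightarrow> X' \<otimes> Y'\<close> for \<open>f : X \<rightarrow> X'\<close> and \<open>g : Y \<rightarrow> Y'\<close>.\<close>

definition tar :: "('o, 'm, 'z) moncat_scheme \<Rightarrow> 'o \<Rightarrow> 'o \<Rightarrow> 'o \<Rightarrow> 'o \<Rightarrow> 'm \<Rightarrow> 'm \<Rightarrow> 'm" where
  "tar M X X' Y Y' f g = farr (Tensor M) (X, Y) (X', Y') (f, g)"

text \<open>The associator goes \<open>(X \<otimes> Y) \<otimes> Z \<rightarrow> X \<otimes> (Y \<otimes> Z)\<close>, the unitors \<open>I \<otimes> X \<rightarrow> X\<close> and \<open>X \<otimes> I \<rightarrow> X\<close>.\<close>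

locale monoidal_category = category M
  for M :: "('o, 'm, 'z) moncat_scheme" +
  assumes Tensor_functor: "is_functor (prod_cat M M) M (Tensor M)"
    and Unit_in: "Unit M \<in> Obj M"
    and Assoc_iso: "\<lbrakk>X \<in> Obj M; Y \<in> Obj M; Z \<in> Obj M\<rbrakk>
      \<Longrightarrow> is_iso M (tob M (tob M X Y) Z) (tob M X (tob M Y Z)) (Assoc M X Y Z)"
    and LUnit_iso: "X \<in> Obj M \<Longrightarrow> is_iso M (tob M (Unit M) X) X (LUnit M X)"
    and RUnit_iso: "X \<in> Obj M \<Longrightarrow> is_iso M (tob M X (Unit M)) X (RUnit M X)"
    and Assoc_natural: "\<lbrakk>X \<in> Obj M; X' \<in> Obj M; Y \<in> Obj M; Y' \<in> Obj M; Z \<in> Obj M; Z' \<in> Obj M;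
        f \<in> Hom M X X'; g \<in> Hom M Y Y'; h \<in> Hom M Z Z'\<rbrakk>
      \<Longrightarrow> Comp M (tob M (tob M X Y) Z) (tob M (tob M X' Y') Z') (tob M X' (tob M Y' Z'))
            (Assoc M X' Y' Z')
            (tar M (tob M X Y) (tob M X' Y') Z Z' (tar M X X' Y Y' f g) h)
        = Comp M (tob M (tob M X Y) Z) (tob M X (tob M Y Z)) (tob M X' (tob M Y' Z'))
            (tar M X X' (tob M Y Z) (tob M Y' Z') f (tar M Y Y' Z Z' g h))
            (Assoc M X Y Z)"
    and LUnit_natural: "\<lbrakk>X \<in> Obj M; X' \<in> Obj M; f \<in> Hom M X X'\<rbrakk>
      \<Longrightarrow> Comp M (tob M (Unit M) X) (tob M (Unit M) X') X' (LUnit M X')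
            (tar M (Unit M) (Unit M) X X' (Ident M (Unit M)) f)
        = Comp M (tob M (Unit M) X) X X' f (LUnit M X)"
    and RUnit_natural: "\<lbrakk>X \<in> Obj M; X' \<in> Obj M; f \<in> Hom M X X'\<rbrakk>
      \<Longrightarrow> Comp M (tob M X (Unit M)) (tob M X' (Unit M)) X' (RUnit M X')
            (tar M X X' (Unit M) (Unit M) f (Ident M (Unit M)))
        = Comp M (tob M X (Unit M)) X X' f (RUnit M X)"
    and pentagon: "\<lbrakk>W \<in> Obj M; X \<in> Obj M; Y \<in> Obj M; Z \<in> Obj M\<rbrakk>
      \<Longrightarrow> Comp M (tob M (tob M (tob M W X) Y) Z) (tob M (tob M W X) (tob M Y Z))
              (tob M W (tob M X (tob M Y Z)))
            (Assoc M W X (tob M Y Z)) (Assoc M (tob M W X) Y Z)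
        = Comp M (tob M (tob M (tob M W X) Y) Z) (tob M W (tob M (tob M X Y) Z))
              (tob M W (tob M X (tob M Y Z)))
            (tar M W W (tob M (tob M X Y) Z) (tob M X (tob M Y Z)) (Ident M W) (Assoc M X Y Z))
            (Comp M (tob M (tob M (tob M W X) Y) Z) (tob M (tob M W (tob M X Y)) Z)
                (tob M W (tob M (tob M X Y) Z))
              (Assoc M W (tob M X Y) Z)
              (tar M (tob M (tob M W X) Y) (tob M W (tob M X Y)) Z Z
                (Assoc M W X Y) (Ident M Z)))"
    and triangle: "\<lbrakk>X \<in> Obj M; Y \<in> Obj M\<rbrakk>
      \<Longrightarrow> Comp M (tob M (tob M X (Unit M)) Y) (tob M X (tob M (Unit M) Y)) (tob M X Y)
            (tar M X X (tob M (Unit M) Y) Y (Ident M X) (LUnit M Y)) (Assoc M X (Unit M) Y)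
        = tar M (tob M X (Unit M)) X Y Y (RUnit M X) (Ident M Y)"

locale monoid_object =
  fixes M :: "('o, 'm, 'z) moncat_scheme" and T :: 'o and e m :: 'm
  assumes T_in: "T \<in> Obj M"
    and e_in: "e \<in> Hom M (Unit M) T"
    and m_in: "m \<in> Hom M (tob M T T) T"
    and m_assoc: "Comp M (tob M (tob M T T) T) (tob M T T) T m
          (tar M (tob M T T) T T T m (Ident M T))
      = Comp M (tob M (tob M T T) T) (tob M T T) T m
          (Comp M (tob M (tob M T T) T) (tob M T (tob M T T)) (tob M T T)
            (tar M T T (tob M T T) T (Ident M T) m) (Assoc M T T T))"
    and m_unit_left: "Comp M (tob M (Unit M) T) (tob M T T) T m
          (tar M (Unit M) T T T e (Ident M T)) = LUnit M T"
    and m_unit_right: "Comp M (tob M T (Unit M)) (tob M T T) T m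
          (tar M T T (Unit M) T (Ident M T) e) = RUnit M T"


section \<open>Metamodels\<close>

text \<open>
  \<open>mm P\<close> is the functor \<open>M\<^sup>o\<^sup>p \<times> C\<^sup>o\<^sup>p \<times> C \<rightarrow> SET\<close>, \<open>mm_unit P A\<close> the chosen element of \<open>\<Phi>\<^sub>I(A,A)\<close>, and
  \<open>mm_mult P X Y A B D y x\<close> the element of \<open>\<Phi>\<^bsub>Y\<otimes>X\<^esub>(A,D)\<close> assigned to \<open>y \<in> \<Phi>\<^sub>Y(B,D)\<close> and
  \<open>x \<in> \<Phi>\<^sub>X(A,B)\<close>.
\<close>

record ('x, 'xm, 'c, 'cm, 's) metamodel_data =
  mm :: "('x \<times> 'c \<times> 'c, 'xm \<times> 'cm \<times> 'cm, 's set, 's \<Rightarrow> 's) ftor"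
  mm_unit :: "'c \<Rightarrow> 's"
  mm_mult :: "'x \<Rightarrow> 'x \<Rightarrow> 'c \<Rightarrow> 'c \<Rightarrow> 'c \<Rightarrow> 's \<Rightarrow> 's \<Rightarrow> 's"

definition mm_set :: "('x, 'xm, 'c, 'cm, 's) metamodel_data \<Rightarrow> 'x \<Rightarrow> 'c \<Rightarrow> 'c \<Rightarrow> 's set" where
  "mm_set P X A B = fobj (mm P) (X, A, B)"

text \<open>\<open>(\<Phi>\<^sub>f)\<^bsub>A,B\<^esub> : \<Phi>\<^sub>X(A,B) \<rightarrow> \<Phi>\<^bsub>X'\<^esub>(A,B)\<close> for \<open>f : X' \<rightarrow> X\<close>.\<close>

definition mm_re :: "('c, 'cm, 'z) cat_scheme \<Rightarrow> ('x, 'xm, 'c, 'cm, 's) metamodel_data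
    \<Rightarrow> 'x \<Rightarrow> 'x \<Rightarrow> 'xm \<Rightarrow> 'c \<Rightarrow> 'c \<Rightarrow> 's \<Rightarrow> 's" where
  "mm_re C P X X' f A B = farr (mm P) (X, A, B) (X', A, B) (f, Ident C A, Ident C B)"

text \<open>\<open>\<Phi>\<^sub>X(f,B) : \<Phi>\<^sub>X(A,B) \<rightarrow> \<Phi>\<^sub>X(A',B)\<close> for \<open>f : A' \<rightarrow> A\<close>.\<close>

definition mm_left :: "('x, 'xm, 'z1) moncat_scheme \<Rightarrow> ('c, 'cm, 'z2) cat_scheme
    \<Rightarrow> ('x, 'xm, 'c, 'cm, 's) metamodel_data \<Rightarrow> 'x \<Rightarrow> 'c \<Rightarrow> 'c \<Rightarrow> 'cm \<Rightarrow> 'c \<Rightarrow> 's \<Rightarrow> 's" where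
  "mm_left M C P X A A' f B = farr (mm P) (X, A, B) (X, A', B) (Ident M X, f, Ident C B)"

text \<open>\<open>\<Phi>\<^sub>X(A,g) : \<Phi>\<^sub>X(A,B) \<rightarrow> \<Phi>\<^sub>X(A,B')\<close> for \<open>g : B \<rightarrow> B'\<close>.\<close>

definition mm_right :: "('x, 'xm, 'z1) moncat_scheme \<Rightarrow> ('c, 'cm, 'z2) cat_scheme
    \<Rightarrow> ('x, 'xm, 'c, 'cm, 's) metamodel_data \<Rightarrow> 'x \<Rightarrow> 'c \<Rightarrow> 'c \<Rightarrow> 'c \<Rightarrow> 'cm \<Rightarrow> 's \<Rightarrow> 's" where
  "mm_right M C P X A B B' g = farr (mm P) (X, A, B) (X, A, B') (Ident M X, Ident C A, g)"

text \<open>The functor \<open>\<Phi>\<^sub>X : C\<^sup>o\<^sup>p \<times> C \<rightarrow> SET\<close>.\<close>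

definition mm_at :: "('x, 'xm, 'z1) moncat_scheme \<Rightarrow> ('c, 'cm, 'z2) cat_scheme
    \<Rightarrow> ('x, 'xm, 'c, 'cm, 's) metamodel_data \<Rightarrow> 'x \<Rightarrow> ('c, 'cm, 'c, 'cm, 's) prof" where
  "mm_at M C P X = mk_ftor (prod_cat (op_cat C) C) (\<lambda>(A, B). fobj (mm P) (X, A, B))
     (\<lambda>(A, B) (A', B') (f, g). farr (mm P) (X, A, B) (X, A', B') (Ident M X, f, g))"

locale metamodel = M: monoidal_category M + C: category C
  for M :: "('x, 'xm, 'z1) moncat_scheme" and C :: "('c, 'cm, 'z2) cat_scheme" +
  fixes P :: "('x, 'xm, 'c, 'cm, 's) metamodel_data"
  assumes mm_functor: "is_functor (prod_cat (op_cat M) (prod_cat (op_cat C) C)) set_cat (mm P)"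
    and mm_unit_in: "A \<in> Obj C \<Longrightarrow> mm_unit P A \<in> mm_set P (Unit M) A A"
    and mm_unit_extranatural: "\<lbrakk>A \<in> Obj C; B \<in> Obj C; f \<in> Hom C A B\<rbrakk>
      \<Longrightarrow> mm_right M C P (Unit M) A A B f (mm_unit P A)
        = mm_left M C P (Unit M) B A f B (mm_unit P B)"
    and mm_mult_in: "\<lbrakk>X \<in> Obj M; Y \<in> Obj M; A \<in> Obj C; B \<in> Obj C; D \<in> Obj C;
        y \<in> mm_set P Y B D; x \<in> mm_set P X A B\<rbrakk>
      \<Longrightarrow> mm_mult P X Y A B D y x \<in> mm_set P (tob M Y X) A D"
    and mm_mult_natural_M: "\<lbrakk>X \<in> Obj M; X' \<in> Obj M; Y \<in> Obj M; Y' \<in> Obj M;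
        A \<in> Obj C; B \<in> Obj C; D \<in> Obj C; p \<in> Hom M X' X; q \<in> Hom M Y' Y;
        y \<in> mm_set P Y B D; x \<in> mm_set P X A B\<rbrakk>
      \<Longrightarrow> mm_re C P (tob M Y X) (tob M Y' X') (tar M Y' Y X' X q p) A D (mm_mult P X Y A B D y x)
        = mm_mult P X' Y' A B D (mm_re C P Y Y' q B D y) (mm_re C P X X' p A B x)"
    and mm_mult_natural_left: "\<lbrakk>X \<in> Obj M; Y \<in> Obj M; A \<in> Obj C; A' \<in> Obj C; B \<in> Obj C; D \<in> Obj C;
        f \<in> Hom C A' A; y \<in> mm_set P Y B D; x \<in> mm_set P X A B\<rbrakk>
      \<Longrightarrow> mm_left M C P (tob M Y X) A A' f D (mm_mult P X Y A B D y x)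
        = mm_mult P X Y A' B D y (mm_left M C P X A A' f B x)"
    and mm_mult_natural_right: "\<lbrakk>X \<in> Obj M; Y \<in> Obj M; A \<in> Obj C; B \<in> Obj C; D \<in> Obj C; D' \<in> Obj C;
        g \<in> Hom C D D'; y \<in> mm_set P Y B D; x \<in> mm_set P X A B\<rbrakk>
      \<Longrightarrow> mm_right M C P (tob M Y X) A D D' g (mm_mult P X Y A B D y x)
        = mm_mult P X Y A B D' (mm_right M C P Y B D D' g y) x"
    and mm_mult_extranatural: "\<lbrakk>X \<in> Obj M; Y \<in> Obj M; A \<in> Obj C; B \<in> Obj C; B' \<in> Obj C; D \<in> Obj C;
        h \<in> Hom C B B'; y \<in> mm_set P Y B' D; x \<in> mm_set P X A B\<rbrakk>
      \<Longrightarrow> mm_mult P X Y A B D (mm_left M C P Y B' B h D y) x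
        = mm_mult P X Y A B' D y (mm_right M C P X A B B' h x)"
    and mm_mult_assoc: "\<lbrakk>X \<in> Obj M; Y \<in> Obj M; Z \<in> Obj M;
        A \<in> Obj C; B \<in> Obj C; D \<in> Obj C; E \<in> Obj C;
        z \<in> mm_set P Z D E; y \<in> mm_set P Y B D; x \<in> mm_set P X A B\<rbrakk>
      \<Longrightarrow> mm_re C P (tob M Z (tob M Y X)) (tob M (tob M Z Y) X) (Assoc M Z Y X) A E
            (mm_mult P (tob M Y X) Z A D E z (mm_mult P X Y A B D y x))
        = mm_mult P X (tob M Z Y) A B E (mm_mult P Y Z B D E z y) x"
    and mm_mult_unit_left: "\<lbrakk>X \<in> Obj M; A \<in> Obj C; B \<in> Obj C; x \<in> mm_set P X A B\<rbrakk>
      \<Longrightarrow> mm_mult P X (Unit M) A B B (mm_unit P B) x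
        = mm_re C P X (tob M (Unit M) X) (LUnit M X) A B x"
    and mm_mult_unit_right: "\<lbrakk>X \<in> Obj M; A \<in> Obj C; B \<in> Obj C; x \<in> mm_set P X A B\<rbrakk>
      \<Longrightarrow> mm_mult P (Unit M) X A A B x (mm_unit P A)
        = mm_re C P X (tob M X (Unit M)) (RUnit M X) A B x"

text \<open>The transformation \<open>C(A,B) \<rightarrow> \<Phi>\<^sub>I(A,B)\<close> corresponding to \<open>mm_unit P\<close> by the Yoneda lemma.\<close>

definition mm_unit_at :: "('x, 'xm, 'z1) moncat_scheme \<Rightarrow> ('c, 'cm, 'z2) cat_scheme
    \<Rightarrow> ('x, 'xm, 'c, 'cm, 's) metamodel_data \<Rightarrow> 'c \<Rightarrow> 'c \<Rightarrow> 'cm \<Rightarrow> 's" where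
  "mm_unit_at M C P A B f = mm_right M C P (Unit M) A A B f (mm_unit P A)"


section \<open>Models\<close>

definition mod_cat :: "('x, 'xm, 'z1) moncat_scheme \<Rightarrow> ('c, 'cm, 'z2) cat_scheme
    \<Rightarrow> ('x, 'xm, 'c, 'cm, 's) metamodel_data \<Rightarrow> 'x \<Rightarrow> 'xm \<Rightarrow> 'xm \<Rightarrow> ('c \<times> 's, 'cm) cat" where
  "mod_cat M C P T e m =
    \<lparr>Obj = {(A, \<xi>). A \<in> Obj C \<and> \<xi> \<in> mm_set P T A A \<and>
        mm_re C P T (Unit M) e A A \<xi> = mm_unit P A \<and>
        mm_re C P T (tob M T T) m A A \<xi> = mm_mult P T T A A A \<xi> \<xi>},
     Hom = (\<lambda>(A, \<xi>) (A', \<xi>'). {f \<in> Hom C A A'.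
        mm_right M C P T A A A' f \<xi> = mm_left M C P T A' A f A' \<xi>'}),
     Ident = (\<lambda>X. Ident C (fst X)),
     Comp = (\<lambda>X Y Z g f. Comp C (fst X) (fst Y) (fst Z) g f)\<rparr>"

definition mod_forget :: "('x, 'xm, 'z1) moncat_scheme \<Rightarrow> ('c, 'cm, 'z2) cat_scheme
    \<Rightarrow> ('x, 'xm, 'c, 'cm, 's) metamodel_data \<Rightarrow> 'x \<Rightarrow> 'xm \<Rightarrow> 'xm
    \<Rightarrow> ('c \<times> 's, 'cm, 'c, 'cm) ftor" where
  "mod_forget M C P T e m = mk_ftor (mod_cat M C P T e m) fst (\<lambda>X Y f. f)"

definition mod_trans :: "('x, 'xm, 'z1) moncat_scheme \<Rightarrow> ('c, 'cm, 'z2) cat_scheme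
    \<Rightarrow> ('x, 'xm, 'c, 'cm, 's) metamodel_data \<Rightarrow> 'x \<Rightarrow> 'xm \<Rightarrow> 'xm
    \<Rightarrow> 'c \<times> 's \<Rightarrow> 'c \<times> 's \<Rightarrow> 'cm \<Rightarrow> 's" where
  "mod_trans M C P T e m X Y =
    (if X \<in> Obj (mod_cat M C P T e m) \<and> Y \<in> Obj (mod_cat M C P T e m)
     then \<lambda>f\<in>Hom (mod_cat M C P T e m) X Y. mm_right M C P T (fst X) (fst X) (fst Y) f (snd X)
     else undefined)"

lemma mod_trans_left:
  assumes "X \<in> Obj (mod_cat M C P T e m)" "Y \<in> Obj (mod_cat M C P T e m)"
    and "f \<in> Hom (mod_cat M C P T e m) X Y"
  shows "mod_trans M C P T e m X Y f = mm_left M C P T (fst Y) (fst X) f (fst Y) (snd Y)"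
  using assms by (auto simp: mod_trans_def mod_cat_def)


section \<open>Vertical double cones\<close>

locale vertical_double_cone =
  fixes M :: "('x, 'xm, 'z1) moncat_scheme" and C :: "('c, 'cm, 'z2) cat_scheme"
    and P :: "('x, 'xm, 'c, 'cm, 's) metamodel_data" and T :: 'x and e m :: 'xm
    and A :: "('a, 'am, 'z3) cat_scheme" and V :: "('a, 'am, 'c, 'cm) ftor"
    and v :: "'a \<Rightarrow> 'a \<Rightarrow> 'am \<Rightarrow> 's"
  assumes cone_category: "category A"
    and cone_functor: "is_functor A C V"
    and cone_trans: "prof_square A A C C V V (hom_prof A) (mm_at M C P T) v"
    and cone_unit: "\<lbrakk>a \<in> Obj A; b \<in> Obj A; f \<in> Hom A a b\<rbrakk>
      \<Longrightarrow> mm_re C P T (Unit M) e (fobj V a) (fobj V b) (v a b f)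
        = mm_unit_at M C P (fobj V a) (fobj V b) (farr V a b f)"
    and cone_mult: "\<lbrakk>a \<in> Obj A; b \<in> Obj A; c \<in> Obj A; h \<in> Hom A a b; g \<in> Hom A b c\<rbrakk>
      \<Longrightarrow> mm_re C P T (tob M T T) m (fobj V a) (fobj V c) (v a c (Comp A a b c g h))
        = mm_mult P T T (fobj V a) (fobj V b) (fobj V c) (v b c g) (v a b h)"

text \<open>\<open>K\<close> factors the cone \<open>(A,V,v)\<close> through the category of models.\<close>

locale cone_factorization =
  fixes M :: "('x, 'xm, 'z1) moncat_scheme" and C :: "('c, 'cm, 'z2) cat_scheme"
    and P :: "('x, 'xm, 'c, 'cm, 's) metamodel_data" and T :: 'x and e m :: 'xm
    and A :: "('a, 'am, 'z3) cat_scheme" and V :: "('a, 'am, 'c, 'cm) ftor"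
    and v :: "'a \<Rightarrow> 'a \<Rightarrow> 'am \<Rightarrow> 's"
    and K :: "('a, 'am, 'c \<times> 's, 'cm) ftor"
  assumes fact_functor: "is_functor A (mod_cat M C P T e m) K"
    and fact_forget: "comp_ftor A (mod_forget M C P T e m) K = V"
    and fact_trans: "\<lbrakk>a \<in> Obj A; b \<in> Obj A; f \<in> Hom A a b\<rbrakk>
      \<Longrightarrow> mod_trans M C P T e m (fobj K a) (fobj K b) (farr K a b f) = v a b f"

end

theory Submission
  imports Defs
begin

text \<open>
  For a cone \<open>(A, V, v)\<close> the element \<open>v a a id\<close> is a model structure on \<open>V a\<close>, by the two cone
  equations at identities, and naturality gives \<open>v f = \<Phi>\<^sub>T(1,Vf)(v id) = \<Phi>\<^sub>T(Vf,1)(v id)\<close>. So every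
  \<open>V f\<close> is a homomorphism and \<open>v\<close> is determined by its values at identities. Hence a factorization
  must send \<open>a\<close> to \<open>(V a, v a a id)\<close>, and the hypothesis on a square \<open>\<theta>\<close> says exactly that its values
  are homomorphisms between these models.
\<close>

section \<open>Opposites, products and sets\<close>

lemma op_cat_simps [simp]:
  "Obj (op_cat C) = Obj C" "Hom (op_cat C) X Y = Hom C Y X" "Ident (op_cat C) = Ident C"
  "Comp (op_cat C) X Y Z g f = Comp C Z Y X f g"
  by (simp_all add: op_cat_def)

lemma prod_cat_simps [simp]:
  "Obj (prod_cat C D) = Obj C \<times> Obj D"
  "Hom (prod_cat C D) X Y = Hom C (fst X) (fst Y) \<times> Hom D (snd X) (snd Y)"
  "Ident (prod_cat C D) X = (Ident C (fst X), Ident D (snd X))"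
  "Comp (prod_cat C D) X Y Z g f = (Comp C (fst X) (fst Y) (fst Z) (fst g) (fst f),
     Comp D (snd X) (snd Y) (snd Z) (snd g) (snd f))"
  by (simp_all add: prod_cat_def)

lemma set_cat_simps [simp]:
  "Obj set_cat = UNIV" "Hom set_cat X Y = (X \<rightarrow>\<^sub>E Y)" "Ident set_cat X = (\<lambda>x\<in>X. x)"
  "Comp set_cat X Y Z g f = compose X g f"
  by (simp_all add: set_cat_def)

lemma category_op_cat: "category C \<Longrightarrow> category (op_cat C)"
  by (auto simp: category_def)

lemma category_prod_cat: "category C \<Longrightarrow> category D \<Longrightarrow> category (prod_cat C D)"
  by (auto simp: category_def)

text \<open>The unit laws hold on the nose because maps are \<open>undefined\<close> off their
  domain: composing with an identity restricts to that domain, which leaves an extensional map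
  unchanged.\<close>

lemma category_set_cat: "category set_cat"
proof
  show "Comp set_cat X X Y f (Ident set_cat X) = f" if "f \<in> Hom set_cat X Y" for X Y and f :: "'a \<Rightarrow> 'a"
    using that by (auto simp: compose_def restrict_def PiE_def extensional_def)
  show "Comp set_cat X Y Y (Ident set_cat Y) f = f" if "f \<in> Hom set_cat X Y" for X Y and f :: "'a \<Rightarrow> 'a"
    using that by (auto simp: compose_def restrict_def PiE_def extensional_def Pi_def)
qed (auto simp: compose_def restrict_def PiE_def extensional_def Pi_def)

section \<open>Functors with default values off their domain\<close>

lemma mk_ftor_simps [simp]:
  "X \<in> Obj A \<Longrightarrow> fobj (mk_ftor A fo fa) X = fo X"
  "X \<in> Obj A \<Longrightarrow> Y \<in> Obj A \<Longrightarrow> f \<in> Hom A X Y \<Longrightarrow> farr (mk_ftor A fo fa) X Y f = fa X Y f"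
  by (simp_all add: mk_ftor_def)

text \<open>The guards in \<open>mk_ftor\<close> supply the two \<open>ext\<close> axioms. At
  identities and composites they can be discharged because \<open>A\<close> is a category, so the
  functor laws reduce to those of \<open>fo\<close> and \<open>fa\<close>.\<close>

lemma is_functor_mk_ftor:
  assumes "category A" "category B"
    and "\<And>X. X \<in> Obj A \<Longrightarrow> fo X \<in> Obj B"
    and "\<And>X Y f. \<lbrakk>X \<in> Obj A; Y \<in> Obj A; f \<in> Hom A X Y\<rbrakk> \<Longrightarrow> fa X Y f \<in> Hom B (fo X) (fo Y)"
    and "\<And>X. X \<in> Obj A \<Longrightarrow> fa X X (Ident A X) = Ident B (fo X)"
    and "\<And>X Y Z f g. \<lbrakk>X \<in> Obj A; Y \<in> Obj A; Z \<in> Obj A; f \<in> Hom A X Y; g \<in> Hom A Y Z\<rbrakk>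
      \<Longrightarrow> fa X Z (Comp A X Y Z g f) = Comp B (fo X) (fo Y) (fo Z) (fa Y Z g) (fa X Y f)"
  shows "is_functor A B (mk_ftor A fo fa)"
proof -
  interpret A: category A by fact
  show ?thesis
    by (intro is_functor.intro)
      (use assms in \<open>auto simp: A.Ident_in A.Comp_in\<close>, auto simp: mk_ftor_def)
qed

text \<open>Off the domain both functors are \<open>undefined\<close> by the \<open>ext\<close>
  axioms, so agreement on the domain already gives equal records.\<close>

lemma is_functor_eqI:
  assumes "is_functor A B F" "is_functor A B' G"
    and "\<And>X. X \<in> Obj A \<Longrightarrow> fobj F X = fobj G X"
    and "\<And>X Y f. \<lbrakk>X \<in> Obj A; Y \<in> Obj A; f \<in> Hom A X Y\<rbrakk> \<Longrightarrow> farr F X Y f = farr G X Y f"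
  shows "F = G"
proof -
  have "fobj F X = fobj G X" for X
    using assms is_functor.fobj_ext by (metis (no_types))
  moreover have "farr F X Y f = farr G X Y f" for X Y f
    using assms(4) is_functor.farr_ext[OF assms(1), of X Y f] is_functor.farr_ext[OF assms(2), of X Y f]
    by metis
  ultimately show ?thesis
    by (intro ftor.equality) (auto simp: fun_eq_iff)
qed

section \<open>Hom-functors as profunctors\<close>

lemma fobj_hom_prof [simp]:
  "X \<in> Obj C \<Longrightarrow> Y \<in> Obj C \<Longrightarrow> fobj (hom_prof C) (X, Y) = Hom C X Y"
  by (simp add: hom_prof_def)

lemma farr_hom_prof:
  "\<lbrakk>X \<in> Obj C; Y \<in> Obj C; X' \<in> Obj C; Y' \<in> Obj C; f \<in> Hom C X' X; g \<in> Hom C Y Y'; h \<in> Hom C X Y\<rbrakk>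
    \<Longrightarrow> farr (hom_prof C) (X, Y) (X', Y') (f, g) h = Comp C X' Y Y' g (Comp C X' X Y h f)"
  by (simp add: hom_prof_def)

lemma profunctor_hom_prof:
  assumes "category C"
  shows "profunctor C C (hom_prof C)"
proof -
  interpret category C by fact
  show ?thesis
    unfolding hom_prof_def
  proof (intro profunctor.intro is_functor_mk_ftor category_prod_cat category_op_cat category_set_cat)
    fix X :: "'a \<times> 'a" assume "X \<in> Obj (prod_cat (op_cat C) C)"
    then show "(case X of (X, Y) \<Rightarrow> \<lambda>(X', Y') (f, g). \<lambda>h\<in>Hom C X Y. Comp C X' Y Y' g (Comp C X' X Y h f))
        X (Ident (prod_cat (op_cat C) C) X) = Ident set_cat (case X of (X, Y) \<Rightarrow> Hom C X Y)"
      by (auto simp: Comp_Ident_left Comp_Ident_right split: prod.splits)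
  next
    fix X Y Z :: "'a \<times> 'a" and f g :: "'b \<times> 'b"
    assume XYZ: "X \<in> Obj (prod_cat (op_cat C) C)" "Y \<in> Obj (prod_cat (op_cat C) C)"
      "Z \<in> Obj (prod_cat (op_cat C) C)"
      "f \<in> Hom (prod_cat (op_cat C) C) X Y" "g \<in> Hom (prod_cat (op_cat C) C) Y Z"
    obtain X1 X2 Y1 Y2 Z1 Z2 f1 f2 g1 g2 where eqs: "X = (X1, X2)" "Y = (Y1, Y2)" "Z = (Z1, Z2)"
      "f = (f1, f2)" "g = (g1, g2)" by (metis surj_pair)
    \<comment> \<open>Both sides compose \<open>g1\<close>, \<open>f1\<close>, \<open>h\<close>,
      \<open>f2\<close>, \<open>g2\<close> in this order with different brackets; \<open>g1\<close>
      comes first because the first variable is contravariant.\<close>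
    have "Comp C Z1 X2 Z2 (Comp C X2 Y2 Z2 g2 f2) (Comp C Z1 X1 X2 h (Comp C Z1 Y1 X1 f1 g1))
      = Comp C Z1 Y2 Z2 g2 (Comp C Z1 Y1 Y2 (Comp C Y1 X2 Y2 f2 (Comp C Y1 X1 X2 h f1)) g1)"
      if "h \<in> Hom C X1 X2" for h
      using XYZ that unfolding eqs by (simp add: Comp_assoc Comp_in)
    then show "(case X of (X, Y) \<Rightarrow> \<lambda>(X', Y') (f, g). \<lambda>h\<in>Hom C X Y. Comp C X' Y Y' g (Comp C X' X Y h f))
        Z (Comp (prod_cat (op_cat C) C) X Y Z g f)
      = Comp set_cat (case X of (X, Y) \<Rightarrow> Hom C X Y) (case Y of (X, Y) \<Rightarrow> Hom C X Y)
        (case Z of (X, Y) \<Rightarrow> Hom C X Y)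
        ((case Y of (X, Y) \<Rightarrow> \<lambda>(X', Y') (f, g). \<lambda>h\<in>Hom C X Y. Comp C X' Y Y' g (Comp C X' X Y h f)) Z g)
        ((case X of (X, Y) \<Rightarrow> \<lambda>(X', Y') (f, g). \<lambda>h\<in>Hom C X Y. Comp C X' Y Y' g (Comp C X' X Y h f)) Y f)"
      using XYZ unfolding eqs by (auto simp: compose_def Comp_in intro!: restrict_ext)
  qed (use assms in \<open>auto simp: Comp_in split: prod.splits\<close>)
qed

section \<open>The actions on a metamodel\<close>

context metamodel
begin

lemma act_in:
  assumes "X \<in> Obj M" "X' \<in> Obj M" "A \<in> Obj C" "A' \<in> Obj C" "B \<in> Obj C" "B' \<in> Obj C"
    and "p \<in> Hom M X' X" "f \<in> Hom C A' A" "g \<in> Hom C B B'" "x \<in> mm_set P X A B"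
  shows "farr (mm P) (X, A, B) (X', A', B') (p, f, g) x \<in> mm_set P X' A' B'"
  using is_functor.farr_in[OF mm_functor, of "(X, A, B)" "(X', A', B')" "(p, f, g)"] assms
  by (auto simp: mm_set_def)

lemma act_Ident:
  assumes "X \<in> Obj M" "A \<in> Obj C" "B \<in> Obj C" "x \<in> mm_set P X A B"
  shows "farr (mm P) (X, A, B) (X, A, B) (Ident M X, Ident C A, Ident C B) x = x"
  using is_functor.farr_Ident[OF mm_functor, of "(X, A, B)"] assms
  by (auto simp: mm_set_def)

text \<open>The commutation rules for the one-sided actions all come from merging two successive
  actions into one. The first two variables are contravariant, hence the reversed
  composites.\<close>

lemma act_Comp:
  assumes "X \<in> Obj M" "X' \<in> Obj M" "X'' \<in> Obj M" "A \<in> Obj C" "A' \<in> Obj C" "A'' \<in> Obj C"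
    and "B \<in> Obj C" "B' \<in> Obj C" "B'' \<in> Obj C"
    and "p \<in> Hom M X' X" "f \<in> Hom C A' A" "g \<in> Hom C B B'"
    and "p' \<in> Hom M X'' X'" "f' \<in> Hom C A'' A'" "g' \<in> Hom C B' B''" "x \<in> mm_set P X A B"
  shows "farr (mm P) (X', A', B') (X'', A'', B'') (p', f', g')
      (farr (mm P) (X, A, B) (X', A', B') (p, f, g) x)
    = farr (mm P) (X, A, B) (X'', A'', B'')
      (Comp M X'' X' X p p', Comp C A'' A' A f f', Comp C B B' B'' g' g) x"
  using is_functor.farr_Comp[OF mm_functor, of "(X, A, B)" "(X', A', B')" "(X'', A'', B'')"
      "(p, f, g)" "(p', f', g')"] assms
  by (auto simp: mm_set_def compose_eq)

text \<open>Fixing the first variable means acting there by \<open>Ident M T\<close>; the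
  composition law survives because this identity composed with itself is itself.\<close>

lemma profunctor_mm_at:
  assumes "T \<in> Obj M"
  shows "profunctor C C (mm_at M C P T)"
  unfolding mm_at_def
proof (intro profunctor.intro is_functor_mk_ftor category_prod_cat category_op_cat category_set_cat
    C.category_axioms; clarsimp?)
  fix A B assume "A \<in> Obj C" "B \<in> Obj C"
  then show "farr (mm P) (T, A, B) (T, A, B) (Ident M T, Ident C A, Ident C B)
      = (\<lambda>x\<in>fobj (mm P) (T, A, B). x)"
    using is_functor.farr_Ident[OF mm_functor, of "(T, A, B)"] assms by simp
next
  fix A B A' B' f g
  assume "A \<in> Obj C" "B \<in> Obj C" "A' \<in> Obj C" "B' \<in> Obj C" "f \<in> Hom C A' A" "g \<in> Hom C B B'"
  then show "farr (mm P) (T, A, B) (T, A', B') (Ident M T, f, g)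
      \<in> fobj (mm P) (T, A, B) \<rightarrow>\<^sub>E fobj (mm P) (T, A', B')"
    using is_functor.farr_in[OF mm_functor, of "(T, A, B)" "(T, A', B')" "(Ident M T, f, g)"] assms
    by (simp add: M.Ident_in)
next
  fix A B A' B' A'' B'' f g f' g'
  assume "A \<in> Obj C" "B \<in> Obj C" "A' \<in> Obj C" "B' \<in> Obj C" "A'' \<in> Obj C" "B'' \<in> Obj C"
    "f \<in> Hom C A' A" "g \<in> Hom C B B'" "f' \<in> Hom C A'' A'" "g' \<in> Hom C B' B''"
  then show "farr (mm P) (T, A, B) (T, A'', B'') (Ident M T, Comp C A'' A' A f f', Comp C B B' B'' g' g)
      = compose (fobj (mm P) (T, A, B)) (farr (mm P) (T, A', B') (T, A'', B'') (Ident M T, f', g'))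
          (farr (mm P) (T, A, B) (T, A', B') (Ident M T, f, g))"
    using is_functor.farr_Comp[OF mm_functor, of "(T, A, B)" "(T, A', B')" "(T, A'', B'')"
        "(Ident M T, f, g)" "(Ident M T, f', g')"] assms
    by (simp add: M.Ident_in M.Comp_Ident_left)
qed

lemma fobj_mm_at [simp]:
  "A \<in> Obj C \<Longrightarrow> B \<in> Obj C \<Longrightarrow> fobj (mm_at M C P X) (A, B) = mm_set P X A B"
  by (simp add: mm_at_def mm_set_def)

text \<open>The pair \<open>(f, g)\<close> factors as \<open>g\<close> followed by \<open>f\<close>,
  each paired with an identity. This turns naturality of a square into
  \<open>mapsto\<close>form0\<close>

lemma farr_mm_at:
  assumes "X \<in> Obj M" "A \<in> Obj C" "A' \<in> Obj C" "B \<in> Obj C" "B' \<in> Obj C"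
    and "f \<in> Hom C A' A" "g \<in> Hom C B B'" "x \<in> mm_set P X A B"
  shows "farr (mm_at M C P X) (A, B) (A', B') (f, g) x
    = mm_left M C P X A A' f B' (mm_right M C P X A B B' g x)"
  unfolding mm_left_def mm_right_def using assms
  by (simp add: mm_at_def act_Comp M.Ident_in C.Ident_in
      M.Comp_Ident_left C.Comp_Ident_left C.Comp_Ident_right)

lemma mm_left_in:
  "\<lbrakk>X \<in> Obj M; A \<in> Obj C; A' \<in> Obj C; B \<in> Obj C; f \<in> Hom C A' A; x \<in> mm_set P X A B\<rbrakk>
    \<Longrightarrow> mm_left M C P X A A' f B x \<in> mm_set P X A' B"
  unfolding mm_left_def by (simp add: act_in M.Ident_in C.Ident_in)

lemma mm_right_in:
  "\<lbrakk>X \<in> Obj M; A \<in> Obj C; B \<in> Obj C; B' \<in> Obj C; g \<in> Hom C B B'; x \<in> mm_set P X A B\<rbrakk>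
    \<Longrightarrow> mm_right M C P X A B B' g x \<in> mm_set P X A B'"
  unfolding mm_right_def by (simp add: act_in M.Ident_in C.Ident_in)

lemma mm_left_Ident:
  "\<lbrakk>X \<in> Obj M; A \<in> Obj C; B \<in> Obj C; x \<in> mm_set P X A B\<rbrakk>
    \<Longrightarrow> mm_left M C P X A A (Ident C A) B x = x"
  unfolding mm_left_def by (rule act_Ident)

lemma mm_right_Ident:
  "\<lbrakk>X \<in> Obj M; A \<in> Obj C; B \<in> Obj C; x \<in> mm_set P X A B\<rbrakk>
    \<Longrightarrow> mm_right M C P X A B B (Ident C B) x = x"
  unfolding mm_right_def by (rule act_Ident)

lemma mm_left_Comp:
  "\<lbrakk>X \<in> Obj M; A \<in> Obj C; A' \<in> Obj C; A'' \<in> Obj C; B \<in> Obj C;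
    f \<in> Hom C A' A; f' \<in> Hom C A'' A'; x \<in> mm_set P X A B\<rbrakk>
    \<Longrightarrow> mm_left M C P X A A'' (Comp C A'' A' A f f') B x
      = mm_left M C P X A' A'' f' B (mm_left M C P X A A' f B x)"
  unfolding mm_left_def
  by (simp add: act_Comp M.Ident_in C.Ident_in M.Comp_Ident_left C.Comp_Ident_left)

lemma mm_right_Comp:
  "\<lbrakk>X \<in> Obj M; A \<in> Obj C; B \<in> Obj C; B' \<in> Obj C; B'' \<in> Obj C;
    g \<in> Hom C B B'; g' \<in> Hom C B' B''; x \<in> mm_set P X A B\<rbrakk>
    \<Longrightarrow> mm_right M C P X A B B'' (Comp C B B' B'' g' g) x
      = mm_right M C P X A B' B'' g' (mm_right M C P X A B B' g x)"
  unfolding mm_right_def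
  by (simp add: act_Comp M.Ident_in C.Ident_in M.Comp_Ident_left C.Comp_Ident_left)

lemma mm_right_left:
  "\<lbrakk>X \<in> Obj M; A \<in> Obj C; A' \<in> Obj C; B \<in> Obj C; B' \<in> Obj C;
    f \<in> Hom C A' A; g \<in> Hom C B B'; x \<in> mm_set P X A B\<rbrakk>
    \<Longrightarrow> mm_right M C P X A' B B' g (mm_left M C P X A A' f B x)
      = mm_left M C P X A A' f B' (mm_right M C P X A B B' g x)"
  unfolding mm_left_def mm_right_def
  by (simp add: act_Comp M.Ident_in C.Ident_in M.Comp_Ident_left C.Comp_Ident_left
      C.Comp_Ident_right)

lemma mm_re_right:
  "\<lbrakk>X \<in> Obj M; X' \<in> Obj M; A \<in> Obj C; B \<in> Obj C; B' \<in> Obj C;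
    p \<in> Hom M X' X; g \<in> Hom C B B'; x \<in> mm_set P X A B\<rbrakk>
    \<Longrightarrow> mm_re C P X X' p A B' (mm_right M C P X A B B' g x)
      = mm_right M C P X' A B B' g (mm_re C P X X' p A B x)"
  unfolding mm_re_def mm_right_def
  by (simp add: act_Comp M.Ident_in C.Ident_in M.Comp_Ident_left M.Comp_Ident_right
      C.Comp_Ident_left C.Comp_Ident_right)

end


section \<open>The category of models as a cone\<close>

locale metamodel_monoid = metamodel M C P + monoid_object M T e m
  for M :: "('x, 'xm, 'z1) moncat_scheme" and C :: "('c, 'cm, 'z2) cat_scheme"
    and P :: "('x, 'xm, 'c, 'cm, 's) metamodel_data" and T :: 'x and e m :: 'xm
begin

lemma tob_in: "X \<in> Obj M \<Longrightarrow> Y \<in> Obj M \<Longrightarrow> tob M X Y \<in> Obj M"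
  using is_functor.fobj_in[OF M.Tensor_functor, of "(X, Y)"] by (simp add: tob_def)

abbreviation Mod :: "('c \<times> 's, 'cm) cat" where
  "Mod \<equiv> mod_cat M C P T e m"

lemma Obj_Mod: "X \<in> Obj Mod \<longleftrightarrow> fst X \<in> Obj C \<and> snd X \<in> mm_set P T (fst X) (fst X) \<and>
    mm_re C P T (Unit M) e (fst X) (fst X) (snd X) = mm_unit P (fst X) \<and>
    mm_re C P T (tob M T T) m (fst X) (fst X) (snd X)
      = mm_mult P T T (fst X) (fst X) (fst X) (snd X) (snd X)"
  by (simp add: mod_cat_def split_beta)

lemma Hom_Mod: "f \<in> Hom Mod X Y \<longleftrightarrow> f \<in> Hom C (fst X) (fst Y) \<and>
    mm_right M C P T (fst X) (fst X) (fst Y) f (snd X)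
      = mm_left M C P T (fst Y) (fst X) f (fst Y) (snd Y)"
  by (simp add: mod_cat_def split_beta)

lemma Ident_Mod [simp]: "Ident Mod X = Ident C (fst X)"
  and Comp_Mod [simp]: "Comp Mod X Y Z g f = Comp C (fst X) (fst Y) (fst Z) g f"
  by (simp_all add: mod_cat_def)

lemma Comp_in_Mod:
  assumes "X \<in> Obj Mod" "Y \<in> Obj Mod" "Z \<in> Obj Mod" "f \<in> Hom Mod X Y" "g \<in> Hom Mod Y Z"
  shows "Comp C (fst X) (fst Y) (fst Z) g f \<in> Hom Mod X Z"
  using assms T_in unfolding Obj_Mod Hom_Mod
  by (simp add: C.Comp_in mm_right_Comp mm_left_Comp mm_right_left)

lemma category_Mod: "category Mod"
  by unfold_locales
    (use T_in in \<open>auto simp: Comp_in_Mod, auto simp: Hom_Mod Obj_Mod C.Ident_in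
      mm_right_Ident mm_left_Ident C.Comp_Ident_left C.Comp_Ident_right C.Comp_assoc\<close>)

abbreviation U :: "('c \<times> 's, 'cm, 'c, 'cm) ftor" where
  "U \<equiv> mod_forget M C P T e m"

abbreviation u :: "'c \<times> 's \<Rightarrow> 'c \<times> 's \<Rightarrow> 'cm \<Rightarrow> 's" where
  "u \<equiv> mod_trans M C P T e m"

lemma is_functor_U: "is_functor Mod C U"
  unfolding mod_forget_def
  by (intro is_functor_mk_ftor category_Mod C.category_axioms) (auto simp: Obj_Mod Hom_Mod)

lemma fobj_U [simp]: "X \<in> Obj Mod \<Longrightarrow> fobj U X = fst X"
  and farr_U [simp]: "X \<in> Obj Mod \<Longrightarrow> Y \<in> Obj Mod \<Longrightarrow> f \<in> Hom Mod X Y \<Longrightarrow> farr U X Y f = f"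
  by (simp_all add: mod_forget_def)

lemma u_apply: "\<lbrakk>X \<in> Obj Mod; Y \<in> Obj Mod; f \<in> Hom Mod X Y\<rbrakk>
    \<Longrightarrow> u X Y f = mm_right M C P T (fst X) (fst X) (fst Y) f (snd X)"
  by (simp add: mod_trans_def)

lemma prof_square_u: "prof_square Mod Mod C C U U (hom_prof Mod) (mm_at M C P T) u"
proof (intro prof_square.intro is_functor_U profunctor_hom_prof category_Mod profunctor_mm_at T_in)
  fix X Y assume XY: "X \<in> Obj Mod" "Y \<in> Obj Mod"
  then show "u X Y \<in> fobj (hom_prof Mod) (X, Y) \<rightarrow>\<^sub>E fobj (mm_at M C P T) (fobj U X, fobj U Y)"
    using T_in by (auto simp: mod_trans_def Obj_Mod Hom_Mod mm_left_in)
next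
  fix X Y assume "\<not> (X \<in> Obj Mod \<and> Y \<in> Obj Mod)"
  then show "u X Y = undefined" by (auto simp: mod_trans_def)
next
  fix X X' Y Y' f g h
  assume obj: "X \<in> Obj Mod" "X' \<in> Obj Mod" "Y \<in> Obj Mod" "Y' \<in> Obj Mod"
    and hom: "f \<in> Hom Mod X' X" "g \<in> Hom Mod Y Y'" "h \<in> fobj (hom_prof Mod) (X, Y)"
  have h: "h \<in> Hom Mod X Y" using obj hom by simp
  have c: "fst X \<in> Obj C" "fst X' \<in> Obj C" "fst Y \<in> Obj C" "fst Y' \<in> Obj C"
    "f \<in> Hom C (fst X') (fst X)" "g \<in> Hom C (fst Y) (fst Y')" "h \<in> Hom C (fst X) (fst Y)"
    "snd X \<in> mm_set P T (fst X) (fst X)" "snd X' \<in> mm_set P T (fst X') (fst X')"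
    using obj hom h by (auto simp: Obj_Mod Hom_Mod)
  let ?R = "mm_right M C P T" and ?L = "mm_left M C P T"
  have "u X' Y' (farr (hom_prof Mod) (X, Y) (X', Y') (f, g) h)
    = ?R (fst X') (fst X') (fst Y') (Comp C (fst X') (fst Y) (fst Y') g
        (Comp C (fst X') (fst X) (fst Y) h f)) (snd X')"
    using obj hom h by (simp add: farr_hom_prof u_apply Comp_in_Mod)
  also have "\<dots> = ?R (fst X') (fst Y) (fst Y') g (?R (fst X') (fst X) (fst Y) h
      (?R (fst X') (fst X') (fst X) f (snd X')))"
    using c T_in by (simp add: mm_right_Comp C.Comp_in)
  also have "?R (fst X') (fst X') (fst X) f (snd X') = ?L (fst X) (fst X') f (fst X) (snd X)"
    using hom by (simp add: Hom_Mod)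
  also have "?R (fst X') (fst Y) (fst Y') g (?R (fst X') (fst X) (fst Y) h \<dots>)
    = ?L (fst X) (fst X') f (fst Y') (?R (fst X) (fst Y) (fst Y') g (?R (fst X) (fst X) (fst Y) h (snd X)))"
    using c T_in by (simp add: mm_right_left mm_right_in)
  also have "\<dots> = farr (mm_at M C P T) (fobj U X, fobj U Y) (fobj U X', fobj U Y')
      (farr U X' X f, farr U Y Y' g) (u X Y h)"
    using obj hom h c T_in by (simp add: farr_mm_at u_apply mm_right_in)
  finally show "u X' Y' (farr (hom_prof Mod) (X, Y) (X', Y') (f, g) h) = \<dots>" .
qed

lemma vertical_double_cone_Mod: "vertical_double_cone M C P T e m Mod U u"
proof (intro vertical_double_cone.intro category_Mod is_functor_U prof_square_u)
  fix X Y f assume "X \<in> Obj Mod" "Y \<in> Obj Mod" and f: "f \<in> Hom Mod X Y"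
  moreover have "f \<in> Hom C (fst X) (fst Y)" using f by (simp add: Hom_Mod)
  ultimately show "mm_re C P T (Unit M) e (fobj U X) (fobj U Y) (u X Y f)
      = mm_unit_at M C P (fobj U X) (fobj U Y) (farr U X Y f)"
    using T_in e_in M.Unit_in
    by (simp add: u_apply mm_unit_at_def) (simp add: Obj_Mod mm_re_right)
next
  fix X Y Z h g
  assume obj: "X \<in> Obj Mod" "Y \<in> Obj Mod" "Z \<in> Obj Mod"
    and hom: "h \<in> Hom Mod X Y" "g \<in> Hom Mod Y Z"
  have c: "fst X \<in> Obj C" "fst Y \<in> Obj C" "fst Z \<in> Obj C"
    "h \<in> Hom C (fst X) (fst Y)" "g \<in> Hom C (fst Y) (fst Z)"
    "snd X \<in> mm_set P T (fst X) (fst X)" "snd Y \<in> mm_set P T (fst Y) (fst Y)"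
    "tob M T T \<in> Obj M"
    using obj hom T_in by (auto simp: Obj_Mod Hom_Mod tob_in)
  let ?R = "mm_right M C P" and ?L = "mm_left M C P" and ?m = "mm_mult P T T"
  have "mm_re C P T (tob M T T) m (fobj U X) (fobj U Z) (u X Z (Comp Mod X Y Z g h))
    = mm_re C P T (tob M T T) m (fst X) (fst Z)
        (?R T (fst X) (fst X) (fst Z) (Comp C (fst X) (fst Y) (fst Z) g h) (snd X))"
    using obj hom by (simp add: u_apply Comp_in_Mod)
  also have "\<dots> = ?R (tob M T T) (fst X) (fst X) (fst Z) (Comp C (fst X) (fst Y) (fst Z) g h)
      (?m (fst X) (fst X) (fst X) (snd X) (snd X))"
    using c obj T_in m_in by (simp add: mm_re_right C.Comp_in) (simp add: Obj_Mod)
  also have "\<dots> = ?R (tob M T T) (fst X) (fst Y) (fst Z) g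
      (?m (fst X) (fst X) (fst Y) (?R T (fst X) (fst X) (fst Y) h (snd X)) (snd X))"
    using c T_in by (simp add: mm_right_Comp mm_mult_in mm_mult_natural_right)
  also have "?R T (fst X) (fst X) (fst Y) h (snd X) = ?L T (fst Y) (fst X) h (fst Y) (snd Y)"
    using hom by (simp add: Hom_Mod)
  also have "?m (fst X) (fst X) (fst Y) \<dots> (snd X)
    = ?m (fst X) (fst Y) (fst Y) (snd Y) (?R T (fst X) (fst X) (fst Y) h (snd X))"
    using c T_in by (simp add: mm_mult_extranatural)
  also have "?R (tob M T T) (fst X) (fst Y) (fst Z) g \<dots>
    = ?m (fst X) (fst Y) (fst Z) (?R T (fst Y) (fst Y) (fst Z) g (snd Y))
        (?R T (fst X) (fst X) (fst Y) h (snd X))"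
    using c T_in by (simp add: mm_mult_natural_right mm_right_in)
  also have "\<dots> = ?m (fobj U X) (fobj U Y) (fobj U Z) (u Y Z g) (u X Y h)"
    using obj hom by (simp add: u_apply)
  finally show "mm_re C P T (tob M T T) m (fobj U X) (fobj U Z) (u X Z (Comp Mod X Y Z g h)) = \<dots>" .
qed

end


section \<open>Universality\<close>

locale metamodel_cone = metamodel_monoid M C P T e m + vertical_double_cone M C P T e m A V v
  for M :: "('x, 'xm, 'z1) moncat_scheme" and C :: "('c, 'cm, 'z2) cat_scheme"
    and P :: "('x, 'xm, 'c, 'cm, 's) metamodel_data" and T :: 'x and e m :: 'xm
    and A :: "('a, 'am, 'z3) cat_scheme" and V :: "('a, 'am, 'c, 'cm) ftor"
    and v :: "'a \<Rightarrow> 'a \<Rightarrow> 'am \<Rightarrow> 's"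
begin

sublocale A: category A by (rule cone_category)
sublocale V: is_functor A C V by (rule cone_functor)
sublocale v: prof_square A A C C V V "hom_prof A" "mm_at M C P T" v by (rule cone_trans)

lemma v_in: "\<lbrakk>a \<in> Obj A; b \<in> Obj A; f \<in> Hom A a b\<rbrakk> \<Longrightarrow> v a b f \<in> mm_set P T (fobj V a) (fobj V b)"
  using v.component[of a b] by (auto simp: V.fobj_in)

lemma v_right:
  assumes "a \<in> Obj A" "b \<in> Obj A" "f \<in> Hom A a b"
  shows "mm_right M C P T (fobj V a) (fobj V a) (fobj V b) (farr V a b f) (v a a (Ident A a)) = v a b f"
  using v.natural[of a a a b "Ident A a" f "Ident A a"] assms T_in
  by (simp add: A.Ident_in V.fobj_in V.farr_in V.farr_Ident farr_hom_prof farr_mm_at v_in C.Ident_in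
      A.Comp_Ident_left A.Comp_Ident_right mm_left_Ident mm_right_in)

lemma v_left:
  assumes "a \<in> Obj A" "b \<in> Obj A" "f \<in> Hom A a b"
  shows "mm_left M C P T (fobj V b) (fobj V a) (farr V a b f) (fobj V b) (v b b (Ident A b)) = v a b f"
  using v.natural[of b a b b f "Ident A b" "Ident A b"] assms T_in
  by (simp add: A.Ident_in V.fobj_in V.farr_in V.farr_Ident farr_hom_prof farr_mm_at v_in C.Ident_in
      A.Comp_Ident_left A.Comp_Ident_right mm_right_Ident)

lemma cone_model: "a \<in> Obj A \<Longrightarrow> (fobj V a, v a a (Ident A a)) \<in> Obj Mod"
  using cone_unit[of a a "Ident A a"] cone_mult[of a a a "Ident A a" "Ident A a"] M.Unit_in
  by (simp add: Obj_Mod V.fobj_in v_in A.Ident_in mm_unit_at_def V.farr_Ident mm_right_Ident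
      mm_unit_in A.Comp_Ident_left)

lemma cone_hom: "\<lbrakk>a \<in> Obj A; b \<in> Obj A; f \<in> Hom A a b\<rbrakk>
    \<Longrightarrow> farr V a b f \<in> Hom Mod (fobj V a, v a a (Ident A a)) (fobj V b, v b b (Ident A b))"
  by (simp add: Hom_Mod V.farr_in v_right v_left)

definition lift :: "('a, 'am, 'c \<times> 's, 'cm) ftor" where
  "lift = mk_ftor A (\<lambda>a. (fobj V a, v a a (Ident A a))) (farr V)"

lemma is_functor_lift: "is_functor A Mod lift"
  unfolding lift_def
  by (rule is_functor_mk_ftor)
    (simp_all add: cone_category category_Mod cone_model cone_hom V.farr_Ident V.farr_Comp)

lemma cone_factorization_lift: "cone_factorization M C P T e m A V v lift"
proof (rule cone_factorization.intro)
  show "is_functor A Mod lift" by (rule is_functor_lift)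
  show "comp_ftor A U lift = V"
    by (intro ftor.equality ext)
      (auto simp: comp_ftor_def lift_def mk_ftor_def cone_model cone_hom V.fobj_ext V.farr_ext)
  show "u (fobj lift a) (fobj lift b) (farr lift a b f) = v a b f"
    if "a \<in> Obj A" "b \<in> Obj A" "f \<in> Hom A a b" for a b f
    using that by (simp add: lift_def u_apply cone_model cone_hom v_right)
qed

lemma factorization_apply:
  assumes "cone_factorization M C P T e m A V v K"
  shows "a \<in> Obj A \<Longrightarrow> fobj K a = (fobj V a, v a a (Ident A a))"
    and "\<lbrakk>a \<in> Obj A; b \<in> Obj A; f \<in> Hom A a b\<rbrakk> \<Longrightarrow> farr K a b f = farr V a b f"
proof -
  interpret cone_factorization M C P T e m A V v K by fact
  interpret K: is_functor A Mod K by (rule fact_functor)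
  have o: "fobj V a = fst (fobj K a)" if "a \<in> Obj A" for a
    using that by (simp add: fact_forget[symmetric] comp_ftor_def K.fobj_in)
  show "fobj K a = (fobj V a, v a a (Ident A a))" if a: "a \<in> Obj A"
  proof -
    have "v a a (Ident A a) = u (fobj K a) (fobj K a) (Ident Mod (fobj K a))"
      using a by (simp add: fact_trans[symmetric] A.Ident_in K.farr_Ident)
    also have "\<dots> = snd (fobj K a)"
      using K.fobj_in[OF a] category.Ident_in[OF category_Mod K.fobj_in[OF a]] T_in
      by (simp add: u_apply) (simp add: Obj_Mod mm_right_Ident)
    finally show ?thesis using o[OF a] by simp
  qed
  show "farr K a b f = farr V a b f" if "a \<in> Obj A" "b \<in> Obj A" "f \<in> Hom A a b"
    using that by (simp add: fact_forget[symmetric] comp_ftor_def K.fobj_in K.farr_in)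
qed

lemma ex1_factorization: "\<exists>!K. cone_factorization M C P T e m A V v K"
proof (rule ex1I[of _ lift])
  show "cone_factorization M C P T e m A V v lift" by (rule cone_factorization_lift)
  fix K assume K: "cone_factorization M C P T e m A V v K"
  show "K = lift"
    by (rule is_functor_eqI[OF cone_factorization.fact_functor[OF K] is_functor_lift])
      (simp_all add: factorization_apply[OF K] factorization_apply[OF cone_factorization_lift])
qed

end

lemma (in metamodel_monoid) ex1_prof_square_lift:
  assumes cone: "vertical_double_cone M C P T e m A V v"
    and cone': "vertical_double_cone M C P T e m A' V' v'"
    and \<theta>: "prof_square A A' C C V V' H (hom_prof C) \<theta>"
    and eq: "\<And>a a' x. \<lbrakk>a \<in> Obj A; a' \<in> Obj A'; x \<in> fobj H (a, a')\<rbrakk> \<Longrightarrow>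
        mm_right M C P T (fobj V a) (fobj V a) (fobj V' a') (\<theta> a a' x) (v a a (Ident A a))
      = mm_left M C P T (fobj V' a') (fobj V a) (\<theta> a a' x) (fobj V' a') (v' a' a' (Ident A' a'))"
    and K: "cone_factorization M C P T e m A V v K"
    and K': "cone_factorization M C P T e m A' V' v' K'"
  shows "\<exists>!\<sigma>. prof_square A A' Mod Mod K K' H (hom_prof Mod) \<sigma> \<and>
    (\<forall>a\<in>Obj A. \<forall>a'\<in>Obj A'. \<forall>x\<in>fobj H (a, a'). farr U (fobj K a) (fobj K' a') (\<sigma> a a' x) = \<theta> a a' x)"
proof (rule ex1I[of _ \<theta>])
  interpret V: metamodel_cone M C P T e m A V v
    by (intro metamodel_cone.intro metamodel_monoid_axioms cone)
  interpret V': metamodel_cone M C P T e m A' V' v'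
    by (intro metamodel_cone.intro metamodel_monoid_axioms cone')
  interpret \<theta>: prof_square A A' C C V V' H "hom_prof C" \<theta> by fact
  interpret K: is_functor A Mod K by (rule cone_factorization.fact_functor[OF K])
  interpret K': is_functor A' Mod K' by (rule cone_factorization.fact_functor[OF K'])
  note K_apply = V.factorization_apply[OF K] and K'_apply = V'.factorization_apply[OF K']
  have hom_C: "\<theta> a a' x \<in> Hom C (fobj V a) (fobj V' a')"
    if "a \<in> Obj A" "a' \<in> Obj A'" "x \<in> fobj H (a, a')" for a a' x
    using \<theta>.component[of a a'] that by (auto simp: V.V.fobj_in V'.V.fobj_in)
  have hom: "\<theta> a a' x \<in> Hom Mod (fobj K a) (fobj K' a')"
    if "a \<in> Obj A" "a' \<in> Obj A'" "x \<in> fobj H (a, a')" for a a' x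
    using that by (simp add: Hom_Mod K_apply K'_apply hom_C eq)
  have "prof_square A A' Mod Mod K K' H (hom_prof Mod) \<theta>"
  proof (intro prof_square.intro K.is_functor_axioms K'.is_functor_axioms \<theta>.prof_top
      profunctor_hom_prof category_Mod)
    fix a a' assume a: "a \<in> Obj A" "a' \<in> Obj A'"
    then have "\<theta> a a' \<in> extensional (fobj H (a, a'))"
      using \<theta>.component[of a a'] by (auto simp: PiE_def)
    then show "\<theta> a a' \<in> fobj H (a, a') \<rightarrow>\<^sub>E fobj (hom_prof Mod) (fobj K a, fobj K' a')"
      using a hom by (auto simp: K.fobj_in K'.fobj_in PiE_def)
  next
    fix a a' assume "\<not> (a \<in> Obj A \<and> a' \<in> Obj A')"
    then show "\<theta> a a' = undefined" by (rule \<theta>.component_ext)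
  next
    fix a b a' b' f g x
    assume *: "a \<in> Obj A" "b \<in> Obj A" "a' \<in> Obj A'" "b' \<in> Obj A'"
      "f \<in> Hom A b a" "g \<in> Hom A' a' b'" "x \<in> fobj H (a, a')"
    have "\<theta> b b' (farr H (a, a') (b, b') (f, g) x)
      = Comp C (fobj V b) (fobj V' a') (fobj V' b') (farr V' a' b' g)
          (Comp C (fobj V b) (fobj V a) (fobj V' a') (\<theta> a a' x) (farr V b a f))"
      using * \<theta>.natural by (simp add: farr_hom_prof hom_C V.V.fobj_in V'.V.fobj_in
          V.V.farr_in V'.V.farr_in)
    also have "\<dots> = farr (hom_prof Mod) (fobj K a, fobj K' a') (fobj K b, fobj K' b')
        (farr K b a f, farr K' a' b' g) (\<theta> a a' x)"
      using * by (simp add: farr_hom_prof hom K.fobj_in K'.fobj_in K.farr_in K'.farr_in)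
        (simp add: K_apply K'_apply)
    finally show "\<theta> b b' (farr H (a, a') (b, b') (f, g) x) = \<dots>" .
  qed
  then show "prof_square A A' Mod Mod K K' H (hom_prof Mod) \<theta> \<and>
    (\<forall>a\<in>Obj A. \<forall>a'\<in>Obj A'. \<forall>x\<in>fobj H (a, a'). farr U (fobj K a) (fobj K' a') (\<theta> a a' x) = \<theta> a a' x)"
    by (simp add: K.fobj_in K'.fobj_in hom)
  fix \<sigma>
  assume \<sigma>: "prof_square A A' Mod Mod K K' H (hom_prof Mod) \<sigma> \<and>
    (\<forall>a\<in>Obj A. \<forall>a'\<in>Obj A'. \<forall>x\<in>fobj H (a, a'). farr U (fobj K a) (fobj K' a') (\<sigma> a a' x) = \<theta> a a' x)"
  then interpret \<sigma>: prof_square A A' Mod Mod K K' H "hom_prof Mod" \<sigma> by simp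
  show "\<sigma> = \<theta>"
  proof (intro ext)
    fix a a' x
    show "\<sigma> a a' x = \<theta> a a' x"
    proof (cases "a \<in> Obj A \<and> a' \<in> Obj A'")
      case False
      then show ?thesis by (simp only: \<sigma>.component_ext[OF False] \<theta>.component_ext[OF False])
    next
      case True
      note mem = \<sigma>.component[of a a'] \<theta>.component[of a a']
      show ?thesis
      proof (cases "x \<in> fobj H (a, a')")
        case True': True
        have "\<sigma> a a' x \<in> Hom Mod (fobj K a) (fobj K' a')"
          using mem(1) True True' by (auto simp: K.fobj_in K'.fobj_in)
        then have "farr U (fobj K a) (fobj K' a') (\<sigma> a a' x) = \<sigma> a a' x"
          using True by (simp add: K.fobj_in K'.fobj_in)
        then show ?thesis using \<sigma> True True' by auto
      next
        case False
        then show ?thesis using mem True by (simp add: PiE_def extensional_def)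
      qed
    qed
  qed
qed

theorem theorem5p5:
  fixes M :: "('x, 'xm) moncat" and T :: 'x and e m :: 'xm
    and C :: "('c, 'cm) cat" and P :: "('x, 'xm, 'c, 'cm, 's) metamodel_data"
  assumes "monoidal_category M" and "monoid_object M T e m"
    and "category C" and "metamodel M C P"
  shows
    "vertical_double_cone M C P T e m
       (mod_cat M C P T e m) (mod_forget M C P T e m) (mod_trans M C P T e m)
     \<and> (\<forall>(A :: ('a, 'am) cat) V v.
          vertical_double_cone M C P T e m A V v \<longrightarrow>
          (\<exists>!K. cone_factorization M C P T e m A V v K))
     \<and> (\<forall>(A :: ('a, 'am) cat) V v (A' :: ('b, 'bm) cat) V' v'
          (H :: ('a, 'am, 'b, 'bm, 'h) prof) \<theta> K K'.
          vertical_double_cone M C P T e m A V v \<longrightarrow>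
          vertical_double_cone M C P T e m A' V' v' \<longrightarrow>
          profunctor A A' H \<longrightarrow>
          prof_square A A' C C V V' H (hom_prof C) \<theta> \<longrightarrow>
          (\<forall>a\<in>Obj A. \<forall>a'\<in>Obj A'. \<forall>x\<in>fobj H (a, a').
             mm_right M C P T (fobj V a) (fobj V a) (fobj V' a') (\<theta> a a' x)
               (v a a (Ident A a))
             = mm_left M C P T (fobj V' a') (fobj V a) (\<theta> a a' x) (fobj V' a')
                 (v' a' a' (Ident A' a'))) \<longrightarrow>
          cone_factorization M C P T e m A V v K \<longrightarrow>
          cone_factorization M C P T e m A' V' v' K' \<longrightarrow>
          (\<exists>!\<sigma>. prof_square A A' (mod_cat M C P T e m) (mod_cat M C P T e m) K K' H
                  (hom_prof (mod_cat M C P T e m)) \<sigma>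
                \<and> (\<forall>a\<in>Obj A. \<forall>a'\<in>Obj A'. \<forall>x\<in>fobj H (a, a').
                     farr (mod_forget M C P T e m) (fobj K a) (fobj K' a') (\<sigma> a a' x)
                     = \<theta> a a' x)))"
proof -
  interpret metamodel_monoid M C P T e m
    using assms by (intro metamodel_monoid.intro)
  show ?thesis
    by (intro conjI allI impI vertical_double_cone_Mod
        metamodel_cone.ex1_factorization[OF metamodel_cone.intro[OF metamodel_monoid_axioms]]
        ex1_prof_square_lift) auto
qed

end
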